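(* There exists a constant $c_2 > 0$ such that $$s(n) = O\left(\frac{n^2}{(\log n)^{c_2}}\right),$$ i.e. there is a constant $K>0$ with $s(n) \le K n^2 (\log n)^{-c_2}$ for all sufficiently large $n$.
   Context: A skew corner is a configuration of points of the form $(x,y),(x,y+d),(x+d,y')$ with $x,y,y',d \in \mathbb{Z}$; it is non-trivial if $d \neq 0$. A subset of $\mathbb{Z}^2$ is skew corner-free if it contains no non-trivial skew corner. For a positive integer $n$, $[n]=\{1,\dots,n\}$ and $s(n)$ denotes the largest size of a skew corner-free subset of $[n]^2$. *)

theory Defs
  imports Complex_Main "HOL-Library.Landau_Symbols"
begin

definition skew_corner :: "int \<Rightarrow> int \<Rightarrow> int \<Rightarrow> int \<Rightarrow> (int \<times> int) set" where
  "skew_corner x y y' d = {(x, y), (x, y + d), (x + d, y')}"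

definition skew_corner_free :: "(int \<times> int) set \<Rightarrow> bool" where
  "skew_corner_free A \<longleftrightarrow> \<not> (\<exists>x y y' d. d \<noteq> 0 \<and> skew_corner x y y' d \<subseteq> A)"

definition max_skew_corner_free :: "nat \<Rightarrow> nat" where
  "max_skew_corner_free n =
     Max (card ` {A. A \<subseteq> {1..int n} \<times> {1..int n} \<and> skew_corner_free A})"

text \<open>The maximum is taken over a finite nonempty set, so it is attained.\<close>

lemma finite_skew_corner_free_subsets:
  "finite {A. A \<subseteq> {1..int n} \<times> {1..int n} \<and> skew_corner_free A}"
  by (rule finite_subset[of _ "Pow ({1..int n} \<times> {1..int n})"]) auto

lemma skew_corner_free_empty: "skew_corner_free {}"
  by (simp add: skew_corner_free_def skew_corner_def)

end

theory Submission
  imports Defs "HOL-Library.FuncSet" "HOL-Library.Periodic_Fun" "HOL-Library.Complex_Order"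
begin

text \<open>
  If \<open>A\<close> is skew corner-free, let \<open>X\<close> be the set of abscissae of its popular columns and \<open>B x\<close> the
  column over \<open>x\<close>. Then for \<open>x \<in> X\<close> no non-zero element of \<open>B x - B x\<close> lies in \<open>X - x\<close>.
  Since the Fourier transform of the autocorrelation of \<open>B x\<close> is non-negative, this forces a large
  Fourier coefficient of \<open>X\<close> near \<open>x\<close>, and hence a density increment of \<open>X\<close> on a narrower Bohr set
  with one more frequency. The sets \<open>B x\<close> never have to be localised, so their density is not
  lost. After polynomially many steps (in the inverse density) the density of \<open>X\<close> would exceed 1,
  and each step costs only a polynomial factor in the radius, which gives a bound by a power of the
  logarithm.

  Bohr sets are replaced by weights proportional to
  \<open>exp (- M\<^sup>2 * (\<Sum>r\<in>R. 1 - cos (2 * pi * r * t / N)))\<close>, which are positive definite and vary slowly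
  at every scale, so that no regularity of Bohr sets is needed.
\<close>

subsection \<open>Elementary inequalities\<close>

lemma one_minus_cos_le: "1 - cos x \<le> x\<^sup>2 / 2" for x :: real
proof -
  have "1 - cos x = 2 * (sin (x / 2))\<^sup>2"
    using cos_double_sin[of "x / 2"] by simp
  also have "\<dots> \<le> 2 * (x / 2)\<^sup>2"
    using abs_sin_x_le_abs_x[of "x / 2"] by (simp only: abs_le_square_iff)
  finally show ?thesis by (simp add: power2_eq_square)
qed

lemma sin_squared_le: "(sin x)\<^sup>2 \<le> 2 * (1 - cos x)" for x :: real
proof -
  have "(1 - cos x) * (1 + cos x) \<le> (1 - cos x) * 2"
    by (intro mult_left_mono) auto
  then show ?thesis unfolding sin_squared_eq by (simp add: power2_eq_square algebra_simps)
qed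

lemma abs_mult_le_weighted_squares:
  fixes x y c :: real
  assumes "c > 0"
  shows "\<bar>x * y\<bar> \<le> (c * x\<^sup>2 + y\<^sup>2 / c) / 2"
proof -
  have "0 \<le> (c * \<bar>x\<bar> - \<bar>y\<bar>)\<^sup>2 / c" using assms by simp
  also have "\<dots> = c * x\<^sup>2 + y\<^sup>2 / c - 2 * \<bar>x * y\<bar>"
    using assms by (simp add: field_simps power2_eq_square abs_mult)
  finally show ?thesis by simp
qed

lemma abs_cos_add_diff_le:
  fixes a b c :: real
  assumes "c > 0"
  shows "\<bar>cos (a + b) - cos a\<bar> \<le> c * (1 - cos a) + (1 + 1 / c) * (1 - cos b)"
proof -
  have "\<bar>cos (a + b) - cos a\<bar> \<le> \<bar>cos a * (1 - cos b)\<bar> + \<bar>sin a * sin b\<bar>"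
    by (simp add: cos_add algebra_simps)
  also have "\<bar>cos a * (1 - cos b)\<bar> \<le> 1 - cos b"
    by (simp add: abs_mult mult_left_le_one_le)
  also have "\<bar>sin a * sin b\<bar> \<le> (c * (sin a)\<^sup>2 + (sin b)\<^sup>2 / c) / 2"
    by (rule abs_mult_le_weighted_squares[OF assms])
  also have "\<dots> \<le> (c * (2 * (1 - cos a)) + (2 * (1 - cos b)) / c) / 2"
    using assms by (intro divide_right_mono add_mono mult_left_mono sin_squared_le) auto
  finally show ?thesis using assms by (simp add: field_simps)
qed

lemma abs_exp_diff_le: "\<bar>exp x - exp y\<bar> \<le> (exp x + exp y) * \<bar>x - y\<bar>" for x y :: real
proof -
  have "exp x - exp y \<le> (exp x + exp y) * \<bar>x - y\<bar>" for x y :: real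
  proof -
    have "exp x * (1 + (y - x)) \<le> exp x * exp (y - x)"
      by (intro mult_left_mono exp_ge_add_one_self) simp
    then have "exp x - exp y \<le> exp x * (x - y)" by (simp add: algebra_simps exp_diff)
    also have "\<dots> \<le> exp x * \<bar>x - y\<bar>" by (intro mult_left_mono) auto
    also have "\<dots> \<le> (exp x + exp y) * \<bar>x - y\<bar>" by (intro mult_right_mono) auto
    finally show ?thesis .
  qed
  from this[of x y] this[of y x] show ?thesis
    by (simp add: abs_le_iff abs_minus_commute add.commute)
qed

lemma one_minus_cos_2pi_diff_le:
  "1 - cos (2 * pi * (x - y)) \<le> 32 * (frac x - frac y)\<^sup>2"
proof -
  have "2 * pi * (x - y) = 2 * pi * (frac x - frac y) + 2 * pi * of_int (\<lfloor>x\<rfloor> - \<lfloor>y\<rfloor>)"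
    by (simp add: frac_def algebra_simps)
  then have "cos (2 * pi * (x - y)) = cos (2 * pi * (frac x - frac y))"
    by (simp add: cos_add cos_int_2pin sin_int_2pin del: of_int_diff)
  then have "1 - cos (2 * pi * (x - y)) \<le> (2 * pi * (frac x - frac y))\<^sup>2 / 2"
    using one_minus_cos_le by simp
  also have "\<dots> = 2 * pi\<^sup>2 * (frac x - frac y)\<^sup>2"
    by (simp add: power_mult_distrib)
  also have "\<dots> \<le> 2 * 4\<^sup>2 * (frac x - frac y)\<^sup>2"
    using pi_less_4 by (intro mult_right_mono mult_left_mono power_mono) auto
  finally show ?thesis by simp
qed

lemma pigeonhole_frac:
  fixes \<theta> :: "'r \<Rightarrow> 'a \<Rightarrow> real"
  assumes "finite A" "finite R" "m > 0"
  obtains T where "T \<subseteq> A" "card A \<le> card T * m ^ card R"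
    "\<And>r s t. r \<in> R \<Longrightarrow> s \<in> T \<Longrightarrow> t \<in> T \<Longrightarrow> \<bar>frac (\<theta> r t) - frac (\<theta> r s)\<bar> \<le> 1 / real m"
proof -
  define cell where "cell t = (\<lambda>r\<in>R. nat \<lfloor>real m * frac (\<theta> r t)\<rfloor>)" for t
  have "real m * frac z < real m" for z
    using frac_lt_1 assms(3) by simp
  then have "cell \<in> A \<rightarrow> (R \<rightarrow>\<^sub>E {..<m})"
    using assms(3) by (auto simp: cell_def nat_less_iff floor_less_iff)
  then have "\<exists>y\<in>R \<rightarrow>\<^sub>E {..<m}. card (cell -` {y} \<inter> A) * card (R \<rightarrow>\<^sub>E {..<m}) \<ge> card A"
    by (rule pigeonhole_card) (use assms in \<open>auto intro!: finite_PiE simp: PiE_eq_empty_iff\<close>)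
  then obtain y where y: "card A \<le> card (cell -` {y} \<inter> A) * m ^ card R"
    using assms(2) by (auto simp: card_funcsetE)
  have "\<bar>frac (\<theta> r t) - frac (\<theta> r s)\<bar> \<le> 1 / real m"
    if "r \<in> R" "s \<in> cell -` {y} \<inter> A" "t \<in> cell -` {y} \<inter> A" for r s t
  proof -
    have "cell t r = cell s r" using that by simp
    then have "nat \<lfloor>real m * frac (\<theta> r t)\<rfloor> = nat \<lfloor>real m * frac (\<theta> r s)\<rfloor>"
      using \<open>r \<in> R\<close> by (simp add: cell_def)
    then have "\<lfloor>real m * frac (\<theta> r t)\<rfloor> = \<lfloor>real m * frac (\<theta> r s)\<rfloor>"
      by (simp add: nat_eq_iff2)
    then have "\<bar>real m * frac (\<theta> r t) - real m * frac (\<theta> r s)\<bar> \<le> 1" by linarith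
    then have "real m * \<bar>frac (\<theta> r t) - frac (\<theta> r s)\<bar> \<le> 1"
      by (simp add: abs_mult flip: right_diff_distrib)
    then show ?thesis using assms(3) by (simp add: field_simps)
  qed
  with y show thesis by (intro that[of "cell -` {y} \<inter> A"]) auto
qed

subsection \<open>Fourier analysis on cyclic groups\<close>

locale cyclic_sums =
  fixes N :: int
  assumes N_pos: "N > 0"
begin

abbreviation periodic :: "(int \<Rightarrow> 'b) \<Rightarrow> bool" where
  "periodic f \<equiv> periodic_fun_simple f N"

lemma periodic_mod:
  assumes "periodic f"
  shows "f (t mod N) = f t"
proof -
  interpret periodic_fun_simple f N by (rule assms)
  show ?thesis using plus_of_int[of "t mod N" "t div N"] by simp
qed

lemma sum_shift:
  assumes "periodic f"
  shows "(\<Sum>t\<in>{0..<N}. f (t + a)) = (\<Sum>t\<in>{0..<N}. f t)"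
proof -
  have "(\<Sum>t\<in>{0..<N}. f (t + a)) = (\<Sum>t\<in>{0..<N}. f ((t + a) mod N))"
    using assms by (simp add: periodic_mod)
  also have "\<dots> = (\<Sum>t\<in>{0..<N}. f t)"
    by (rule sum.reindex_bij_witness[where i = "\<lambda>t. (t - a) mod N" and j = "\<lambda>t. (t + a) mod N"])
       (use N_pos in \<open>auto simp: mod_simps\<close>)
  finally show ?thesis .
qed

definition chr :: "int \<Rightarrow> int \<Rightarrow> complex" where
  "chr r t = cis (2 * pi * (of_int (r * t) / of_int N))"

lemma chr_commute: "chr r t = chr t r"
  by (simp add: chr_def mult.commute)

lemma chr_add: "chr r (s + t) = chr r s * chr r t"
  by (simp add: chr_def cis_mult ring_distribs add_divide_distrib)

lemma chr_add_left: "chr (q + r) t = chr q t * chr r t"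
  by (metis chr_add chr_commute)

lemma chr_0_left [simp]: "chr 0 t = 1"
  by (simp add: chr_def)

lemma norm_chr [simp]: "norm (chr r t) = 1"
  by (simp add: chr_def)

lemma chr_minus: "chr r (- t) = cnj (chr r t)"
  by (simp add: chr_def cis_cnj)

lemma chr_minus_left: "chr (- r) t = cnj (chr r t)"
  by (metis chr_minus chr_commute)

lemma chr_eq_1_iff: "chr r t = 1 \<longleftrightarrow> N dvd r * t"
proof
  assume "chr r t = 1"
  then have "cos (2 * pi * (of_int (r * t) / of_int N)) = 1"
    by (simp add: chr_def complex_eq_iff)
  then obtain k :: int where "2 * pi * (of_int (r * t) / of_int N) = of_int k * 2 * pi"
    using cos_one_2pi_int by blast
  then have "real_of_int (r * t) = of_int (k * N)"
    using N_pos by (simp add: field_simps)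
  then show "N dvd r * t" by (simp only: of_int_eq_iff) simp
next
  assume "N dvd r * t"
  then obtain k where "r * t = N * k" by blast
  then show "chr r t = 1"
    using N_pos by (simp add: chr_def)
qed

lemma periodic_chr: "periodic (chr r)"
  using chr_eq_1_iff[of r N] by (simp add: periodic_fun_simple_def chr_add)

lemma sum_chr: "(\<Sum>t\<in>{0..<N}. chr r t) = (if N dvd r then of_int N else 0)"
proof (cases "N dvd r")
  case True
  then have "chr r t = 1" for t by (simp add: chr_eq_1_iff)
  then show ?thesis using True N_pos by simp
next
  case False
  have "(\<Sum>t\<in>{0..<N}. chr r t) = (\<Sum>t\<in>{0..<N}. chr r (t + 1))"
    using sum_shift[OF periodic_chr] by simp
  also have "\<dots> = (\<Sum>t\<in>{0..<N}. chr r t) * chr r 1"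
    by (simp add: chr_add sum_distrib_right)
  finally have "(\<Sum>t\<in>{0..<N}. chr r t) = 0"
    using False chr_eq_1_iff[of r 1] by auto
  then show ?thesis using False by simp
qed

definition ft :: "(int \<Rightarrow> complex) \<Rightarrow> int \<Rightarrow> complex" where
  "ft F r = (\<Sum>t\<in>{0..<N}. F t * chr r t)"

lemma fourier_inversion:
  assumes "periodic F"
  shows "(\<Sum>r\<in>{0..<N}. ft F r * chr r (- s)) = of_int N * F s"
proof -
  have "(\<Sum>r\<in>{0..<N}. ft F r * chr r (- s)) =
      (\<Sum>r\<in>{0..<N}. \<Sum>t\<in>{0..<N}. F t * chr (t - s) r)"
    by (simp add: ft_def sum_distrib_right mult.assoc chr_commute[of "_ - _"] flip: chr_add)
  also have "\<dots> = (\<Sum>t\<in>{0..<N}. \<Sum>r\<in>{0..<N}. F t * chr (t - s) r)"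
    by (rule sum.swap)
  also have "\<dots> = (\<Sum>t\<in>{0..<N}. if t = s mod N then F t * of_int N else 0)"
    by (intro sum.cong refl)
       (auto simp: sum_chr mod_eq_dvd_iff[symmetric] simp flip: sum_distrib_left)
  also have "\<dots> = of_int N * F s"
    using N_pos assms by (simp add: periodic_mod mult.commute)
  finally show ?thesis .
qed

lemma norm_sum_chr_squared:
  "of_real ((norm (\<Sum>b\<in>B. chr r b))\<^sup>2) = (\<Sum>b\<in>B. \<Sum>b'\<in>B. chr r (b' - b))"
proof -
  have "of_real ((norm (\<Sum>b\<in>B. chr r b))\<^sup>2) = cnj (\<Sum>b\<in>B. chr r b) * (\<Sum>b\<in>B. chr r b)"
    by (simp only: complex_norm_square mult.commute)
  also have "\<dots> = (\<Sum>b\<in>B. \<Sum>b'\<in>B. chr r (- b) * chr r b')"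
    by (simp add: sum_product chr_minus)
  finally show ?thesis by (simp flip: chr_add)
qed

lemma sum_differences_fourier:
  assumes "periodic F"
  shows "of_int N * (\<Sum>b\<in>B. \<Sum>b'\<in>B. F (b - b')) =
    (\<Sum>r\<in>{0..<N}. ft F r * of_real ((norm (\<Sum>b\<in>B. chr r b))\<^sup>2))"
proof -
  have "of_int N * (\<Sum>b\<in>B. \<Sum>b'\<in>B. F (b - b')) =
      (\<Sum>b\<in>B. \<Sum>b'\<in>B. \<Sum>r\<in>{0..<N}. ft F r * chr r (- (b - b')))"
    by (simp add: fourier_inversion[OF assms] sum_distrib_left del: minus_diff_eq)
  also have "\<dots> = (\<Sum>r\<in>{0..<N}. \<Sum>b\<in>B. \<Sum>b'\<in>B. ft F r * chr r (b' - b))"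
    by (simp add: sum.swap[where B = "{0..<N}"])
  also have "\<dots> = (\<Sum>r\<in>{0..<N}. ft F r * of_real ((norm (\<Sum>b\<in>B. chr r b))\<^sup>2))"
    by (simp only: norm_sum_chr_squared sum_distrib_left)
  finally show ?thesis .
qed

lemma parseval_card:
  assumes "B \<subseteq> {0..<N}"
  shows "(\<Sum>r\<in>{0..<N}. (norm (\<Sum>b\<in>B. chr r b))\<^sup>2) = of_int N * real (card B)"
proof -
  have "finite B" using assms finite_subset by blast
  have "complex_of_real (\<Sum>r\<in>{0..<N}. (norm (\<Sum>b\<in>B. chr r b))\<^sup>2) =
      (\<Sum>r\<in>{0..<N}. \<Sum>b\<in>B. \<Sum>b'\<in>B. chr (b' - b) r)"
    by (simp only: of_real_sum norm_sum_chr_squared chr_commute[of _ "_ - _"])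
  also have "\<dots> = (\<Sum>b\<in>B. \<Sum>b'\<in>B. \<Sum>r\<in>{0..<N}. chr (b' - b) r)"
    by (simp only: sum.swap[where A = "{0..<N}"])
  also have "\<dots> = (\<Sum>b\<in>B. \<Sum>b'\<in>B. if b' = b then of_int N else 0)"
  proof (intro sum.cong refl)
    fix b b' assume "b \<in> B" "b' \<in> B"
    then have "N dvd b' - b \<longleftrightarrow> b' mod N = b mod N" "b' mod N = b'" "b mod N = b"
      using assms by (auto simp: mod_eq_dvd_iff)
    then show "(\<Sum>r\<in>{0..<N}. chr (b' - b) r) = (if b' = b then of_int N else 0)"
      by (simp add: sum_chr)
  qed
  also have "\<dots> = complex_of_real (of_int N * real (card B))"
    using \<open>finite B\<close> by simp
  finally show ?thesis by (simp only: of_real_eq_iff)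
qed

lemma norm_sum_differences_le:
  assumes "periodic F" "B \<subseteq> {0..<N}" "\<And>r. norm (ft F r) \<le> c"
  shows "norm (\<Sum>b\<in>B. \<Sum>b'\<in>B. F (b - b')) \<le> c * real (card B)"
proof -
  have "of_int N * norm (\<Sum>b\<in>B. \<Sum>b'\<in>B. F (b - b')) =
      norm (\<Sum>r\<in>{0..<N}. ft F r * of_real ((norm (\<Sum>b\<in>B. chr r b))\<^sup>2))"
    using N_pos
    by (simp only: sum_differences_fourier[OF assms(1), symmetric]) (simp add: norm_mult)
  also have "\<dots> \<le> (\<Sum>r\<in>{0..<N}. c * (norm (\<Sum>b\<in>B. chr r b))\<^sup>2)"
    by (intro sum_norm_le) (auto simp: norm_mult norm_power intro!: mult_right_mono assms(3))
  also have "\<dots> = of_int N * (c * real (card B))"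
    by (simp only: sum_distrib_left[symmetric] parseval_card[OF assms(2)]) (simp add: mult_ac)
  finally show ?thesis using N_pos by simp
qed

definition posdef :: "(int \<Rightarrow> complex) \<Rightarrow> bool" where
  "posdef f \<longleftrightarrow> periodic f \<and> (\<forall>r. ft f r \<ge> 0)"

lemma posdef_chr: "posdef (chr q)"
proof -
  have "ft (chr q) r = (\<Sum>t\<in>{0..<N}. chr (q + r) t)" for r
    by (simp add: ft_def chr_add_left)
  then show ?thesis
    using N_pos by (simp add: posdef_def periodic_chr sum_chr less_eq_complex_def)
qed

lemma posdef_add: "posdef f \<Longrightarrow> posdef g \<Longrightarrow> posdef (\<lambda>t. f t + g t)"
  by (simp add: posdef_def periodic_fun_simple_def ft_def distrib_right sum.distrib)

lemma posdef_scale: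
  assumes "c \<ge> 0" "posdef f"
  shows "posdef (\<lambda>t. c * f t)"
proof -
  have "ft (\<lambda>t. c * f t) r = c * ft f r" for r
    by (simp add: ft_def sum_distrib_left mult_ac)
  then show ?thesis using assms by (simp add: posdef_def periodic_fun_simple_def)
qed

lemma posdef_const: "c \<ge> 0 \<Longrightarrow> posdef (\<lambda>t. c)"
  using posdef_scale[OF _ posdef_chr[of 0], of c] by simp

lemma posdef_sum:
  "finite R \<Longrightarrow> (\<And>r. r \<in> R \<Longrightarrow> posdef (f r)) \<Longrightarrow> posdef (\<lambda>t. \<Sum>r\<in>R. f r t)"
  by (induction R rule: finite_induct) (simp_all add: posdef_const posdef_add)

lemma posdef_mult:
  assumes f: "posdef f" and g: "posdef g"
  shows "posdef (\<lambda>t. f t * g t)"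
proof -
  have "of_int N * ft (\<lambda>t. f t * g t) r = (\<Sum>q\<in>{0..<N}. ft f q * ft g (r - q))" for r
  proof -
    have "of_int N * ft (\<lambda>t. f t * g t) r = (\<Sum>t\<in>{0..<N}. (of_int N * f t) * (g t * chr r t))"
      by (simp add: ft_def sum_distrib_left mult_ac)
    also have "\<dots> = (\<Sum>t\<in>{0..<N}. \<Sum>q\<in>{0..<N}. ft f q * (g t * chr (r - q) t))"
      using f
      by (simp add: posdef_def fourier_inversion[symmetric] sum_distrib_left sum_distrib_right
          chr_minus chr_minus_left chr_add_left[of _ "- _", simplified] mult_ac)
    also have "\<dots> = (\<Sum>q\<in>{0..<N}. ft f q * ft g (r - q))"
      by (subst sum.swap) (simp only: ft_def sum_distrib_left)
    finally show ?thesis .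
  qed
  then have "of_int N * ft (\<lambda>t. f t * g t) r \<ge> 0" for r
    using f g by (simp add: posdef_def sum_nonneg)
  then show ?thesis
    using f g N_pos
    by (simp add: posdef_def periodic_fun_simple_def less_eq_complex_def zero_le_mult_iff)
qed

lemma posdef_power: "posdef f \<Longrightarrow> posdef (\<lambda>t. f t ^ n)"
  using posdef_const[of 1] by (induction n) (simp_all add: posdef_mult less_eq_complex_def)

lemma posdef_exp:
  assumes "posdef f"
  shows "posdef (\<lambda>t. exp (f t))"
proof -
  have "ft (\<lambda>t. exp (f t)) r \<ge> 0" for r
  proof -
    have sums: "(\<lambda>n. ft (\<lambda>t. f t ^ n /\<^sub>R fact n) r) sums ft (\<lambda>t. exp (f t)) r"
      unfolding ft_def by (intro sums_sum sums_mult2 exp_converges)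
    have "posdef (\<lambda>t. f t ^ n /\<^sub>R fact n)" for n
      using posdef_scale[OF _ posdef_power[OF assms], of "of_real (inverse (fact n))"]
      by (simp add: scaleR_conv_of_real less_eq_complex_def)
    then have terms: "ft (\<lambda>t. f t ^ n /\<^sub>R fact n) r \<ge> 0" for n
      by (simp add: posdef_def)
    have "Re (ft (\<lambda>t. exp (f t)) r) \<ge> 0"
      using sums_le[OF _ sums_zero sums_Re[OF sums]] terms by (simp add: less_eq_complex_def)
    moreover have "Im (ft (\<lambda>t. exp (f t)) r) = 0"
      using sums_Im[OF sums] terms sums_unique2[OF _ sums_zero] by (simp add: less_eq_complex_def)
    ultimately show ?thesis by (simp add: less_eq_complex_def)
  qed
  then show ?thesis using assms by (simp add: posdef_def periodic_fun_simple_def)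
qed

lemma posdef_Re_chr: "posdef (\<lambda>t. of_real (Re (chr r t)))"
proof -
  have "posdef (\<lambda>t. 1 / 2 * (chr r t + chr (- r) t))"
    by (intro posdef_scale posdef_add posdef_chr) (simp add: less_eq_complex_def)
  moreover have "1 / 2 * (chr r t + chr (- r) t) = of_real (Re (chr r t))" for t
    by (simp add: chr_minus_left complex_add_cnj)
  ultimately show ?thesis by simp
qed

lemma posdef_sum_differences_ge:
  assumes "posdef f"
  shows "ft f 0 * of_nat (card B) ^ 2 \<le> of_int N * (\<Sum>b\<in>B. \<Sum>b'\<in>B. f (b - b'))"
proof -
  have "ft f 0 * of_nat (card B) ^ 2 = ft f 0 * of_real ((norm (\<Sum>b\<in>B. chr 0 b))\<^sup>2)"
    by simp
  also have "\<dots> \<le> (\<Sum>r\<in>{0..<N}. ft f r * of_real ((norm (\<Sum>b\<in>B. chr r b))\<^sup>2))"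
    using assms N_pos by (intro member_le_sum) (auto simp: posdef_def less_eq_complex_def)
  also have "\<dots> = of_int N * (\<Sum>b\<in>B. \<Sum>b'\<in>B. f (b - b'))"
    using assms by (simp add: posdef_def sum_differences_fourier)
  finally show ?thesis .
qed

subsection \<open>Weighted averages\<close>

definition weight :: "(int \<Rightarrow> real) \<Rightarrow> bool" where
  "weight w \<longleftrightarrow> periodic w \<and> (\<forall>t. w t \<ge> 0) \<and> (\<Sum>t\<in>{0..<N}. w t) = 1"

definition avg :: "(int \<Rightarrow> real) \<Rightarrow> (int \<Rightarrow> 'a) \<Rightarrow> 'a::real_normed_vector" where
  "avg w f = (\<Sum>t\<in>{0..<N}. w t *\<^sub>R f t)"

lemma avg_const: "weight w \<Longrightarrow> avg w (\<lambda>t. x) = x"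
  by (simp add: avg_def weight_def flip: scaleR_sum_left)

lemma avg_add: "avg w (\<lambda>t. f t + g t) = avg w f + avg w g"
  by (simp add: avg_def scaleR_add_right sum.distrib)

lemma avg_diff: "avg w (\<lambda>t. f t - g t) = avg w f - avg w g"
  by (simp add: avg_def scaleR_diff_right sum_subtractf)

lemma avg_mult_left: "avg w (\<lambda>t. x * f t) = x * avg w f" for x :: "'a::real_normed_algebra"
  by (simp add: avg_def sum_distrib_left)

lemma avg_of_real:
  "avg w (\<lambda>t. of_real (f t)) = (of_real (avg w f) :: 'a::real_normed_algebra_1)"
  by (simp add: avg_def scaleR_conv_of_real)

lemma avg_swap: "avg v (\<lambda>s. avg w (\<lambda>t. f s t)) = avg w (\<lambda>t. avg v (\<lambda>s. f s t))"
  unfolding avg_def scaleR_sum_right by (subst sum.swap) (simp add: mult.commute)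

lemma avg_mono:
  fixes f g :: "int \<Rightarrow> real"
  assumes "weight w" "\<And>t. f t \<le> g t"
  shows "avg w f \<le> avg w g"
  unfolding avg_def using assms by (intro sum_mono scaleR_left_mono) (auto simp: weight_def)

lemma norm_avg_le: "weight w \<Longrightarrow> norm (avg w f) \<le> avg w (\<lambda>t. norm (f t))"
  unfolding avg_def by (intro sum_norm_le) (simp add: weight_def)

lemma avg_nonneg: "weight w \<Longrightarrow> (\<And>t. 0 \<le> f t) \<Longrightarrow> 0 \<le> avg w f" for f :: "int \<Rightarrow> real"
  using avg_mono[of w "\<lambda>t. 0" f] by (simp add: avg_const)

lemma avg_le_1: "weight w \<Longrightarrow> (\<And>t. f t \<le> 1) \<Longrightarrow> avg w f \<le> 1" for f :: "int \<Rightarrow> real"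
  using avg_mono[of w f "\<lambda>t. 1"] by (simp add: avg_const)

lemma norm_avg_mult_le:
  fixes f g :: "int \<Rightarrow> 'a::real_normed_algebra_1"
  assumes "weight w" "\<And>t. norm (f t) \<le> 1"
  shows "norm (avg w (\<lambda>t. f t * g t)) \<le> norm (avg w f) + avg w (\<lambda>t. norm (g t - 1))"
proof -
  have "avg w (\<lambda>t. f t * g t) = avg w f + avg w (\<lambda>t. f t * (g t - 1))"
    by (simp add: algebra_simps flip: avg_add)
  also have "norm \<dots> \<le> norm (avg w f) + avg w (\<lambda>t. norm (f t * (g t - 1)))"
    using norm_avg_le[OF assms(1)] by (intro norm_triangle_le add_left_mono)
  also have "avg w (\<lambda>t. norm (f t * (g t - 1))) \<le> avg w (\<lambda>t. norm (g t - 1))"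
  proof (rule avg_mono[OF assms(1)])
    fix t
    have "norm (f t * (g t - 1)) \<le> norm (f t) * norm (g t - 1)" by (rule norm_mult_ineq)
    also have "\<dots> \<le> norm (g t - 1)" using assms(2) by (simp add: mult_left_le_one_le)
    finally show "norm (f t * (g t - 1)) \<le> norm (g t - 1)" .
  qed
  finally show ?thesis by simp
qed

definition translate_dist :: "(int \<Rightarrow> real) \<Rightarrow> int \<Rightarrow> real" where
  "translate_dist w t = (\<Sum>s\<in>{0..<N}. \<bar>w (s + t) - w s\<bar>)"

lemma norm_avg_translate_le:
  assumes "weight w" "periodic f" "\<And>s. norm (f s) \<le> 1"
  shows "norm (avg w f - avg w (\<lambda>s. f (s + t))) \<le> translate_dist w t"
proof -
  have "periodic (\<lambda>s. w s *\<^sub>R f s)"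
    using assms(1,2) by (simp add: weight_def periodic_fun_simple_def)
  from sum_shift[OF this, of t] have "avg w f = (\<Sum>s\<in>{0..<N}. w (s + t) *\<^sub>R f (s + t))"
    by (simp add: avg_def)
  then have "avg w f - avg w (\<lambda>s. f (s + t)) = (\<Sum>s\<in>{0..<N}. (w (s + t) - w s) *\<^sub>R f (s + t))"
    by (simp add: avg_def scaleR_diff_left sum_subtractf)
  also have "norm \<dots> \<le> translate_dist w t"
    unfolding translate_dist_def using assms(3) by (intro sum_norm_le) (simp add: mult_left_le)
  finally show ?thesis .
qed

lemma norm_avg_smoothing_le:
  assumes "weight w" "weight v" "periodic f" "\<And>s. norm (f s) \<le> 1"
  shows "norm (avg w f - avg w (\<lambda>s. avg v (\<lambda>t. f (s + t)))) \<le> avg v (translate_dist w)"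
proof -
  have "avg w f - avg w (\<lambda>s. avg v (\<lambda>t. f (s + t))) = avg v (\<lambda>t. avg w f - avg w (\<lambda>s. f (s + t)))"
    by (simp add: avg_diff avg_const[OF assms(2)] avg_swap[of w])
  also have "norm \<dots> \<le> avg v (\<lambda>t. norm (avg w f - avg w (\<lambda>s. f (s + t))))"
    by (rule norm_avg_le[OF assms(2)])
  also have "\<dots> \<le> avg v (translate_dist w)"
    by (intro avg_mono assms norm_avg_translate_le)
  finally show ?thesis .
qed

lemma norm_avg_le_avg_norm_avg:
  assumes "weight w" "weight v" "periodic f" "\<And>s. norm (f s) \<le> 1"
  shows "norm (avg w f) \<le> avg w (\<lambda>s. norm (avg v (\<lambda>t. f (s + t)))) + avg v (translate_dist w)"
  using norm_avg_smoothing_le[OF assms] norm_avg_le[OF assms(1), of "\<lambda>s. avg v (\<lambda>t. f (s + t))"]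
    norm_triangle_ineq2[of "avg w f" "avg w (\<lambda>s. avg v (\<lambda>t. f (s + t)))"]
  by linarith

lemma norm_avg_mult_chr_translate_le:
  fixes f :: "int \<Rightarrow> real"
  assumes "weight v" "\<And>t. \<bar>f t - d\<bar> \<le> 1"
  shows "norm (avg v (\<lambda>t. of_real (f (s + t) - d) * chr r (s + t))) \<le>
    \<bar>avg v (\<lambda>t. f (s + t)) - d\<bar> + avg v (\<lambda>t. norm (chr r t - 1))"
proof -
  let ?f = "\<lambda>t. complex_of_real (f (s + t) - d)"
  have "norm (?f t) \<le> 1" for t
    unfolding norm_of_real by (rule assms(2))
  have "avg v (\<lambda>t. ?f t * chr r (s + t)) = chr r s * avg v (\<lambda>t. ?f t * chr r t)"
    by (simp add: chr_add mult_ac flip: avg_mult_left)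
  then have "norm (avg v (\<lambda>t. ?f t * chr r (s + t))) = norm (avg v (\<lambda>t. ?f t * chr r t))"
    by (simp only: norm_mult norm_chr mult_1)
  also have "\<dots> \<le> norm (avg v ?f) + avg v (\<lambda>t. norm (chr r t - 1))"
    by (rule norm_avg_mult_le) fact+
  also have "avg v ?f = of_real (avg v (\<lambda>t. f (s + t)) - d)"
    by (simp only: avg_of_real avg_diff avg_const[OF assms(1)])
  finally show ?thesis unfolding norm_of_real .
qed

text \<open>Without a density increment \<open>\<bar>D s - avg w f\<bar>\<close> is at most
  \<open>2 * (u - avg w f) + avg w f - D s\<close>, where \<open>D s\<close> is the average of \<open>f (s + \<cdot>)\<close> over \<open>v\<close>, and
  the \<open>w\<close>-average of \<open>avg w f - D s\<close> is small by smoothing.\<close>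

lemma norm_fourier_coefficient_le:
  fixes f :: "int \<Rightarrow> real"
  assumes w: "weight w" and v: "weight v"
    and f: "periodic f" "\<And>t. 0 \<le> f t" "\<And>t. f t \<le> 1"
    and smooth: "avg v (translate_dist w) \<le> \<epsilon>"
    and near_1: "avg v (\<lambda>t. norm (chr r t - 1)) \<le> \<epsilon>"
    and no_increment: "\<And>s. avg v (\<lambda>t. f (s + t)) \<le> u" "avg w f \<le> u"
  shows "norm (avg w (\<lambda>s. of_real (f s - avg w f) * chr r s)) \<le> 2 * (u - avg w f) + 3 * \<epsilon>"
proof -
  define d where "d = avg w f"
  define D where "D s = avg v (\<lambda>t. f (s + t))" for s
  define g where "g s = of_real (f s - d) * chr r s" for s
  have "0 \<le> d" "d \<le> 1" using w f by (simp_all add: d_def avg_nonneg avg_le_1)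
  then have balanced: "\<bar>f s - d\<bar> \<le> 1" for s using f(2,3)[of s] by linarith
  then have "norm (g s) \<le> 1" for s
    by (simp only: g_def norm_mult norm_of_real norm_chr mult_1_right)
  moreover have "periodic g"
    using f(1) periodic_chr by (simp add: g_def periodic_fun_simple_def)
  ultimately have "norm (avg w g) \<le> avg w (\<lambda>s. norm (avg v (\<lambda>t. g (s + t)))) + \<epsilon>"
    by (intro order_trans[OF norm_avg_le_avg_norm_avg[OF w v]] add_left_mono smooth)
  also have "avg w (\<lambda>s. norm (avg v (\<lambda>t. g (s + t)))) \<le> avg w (\<lambda>s. (2 * u - d + \<epsilon>) - D s)"
  proof (rule avg_mono[OF w])
    fix s
    have "norm (avg v (\<lambda>t. g (s + t))) \<le> \<bar>D s - d\<bar> + avg v (\<lambda>t. norm (chr r t - 1))"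
      unfolding g_def D_def by (rule norm_avg_mult_chr_translate_le[OF v balanced])
    then show "norm (avg v (\<lambda>t. g (s + t))) \<le> (2 * u - d + \<epsilon>) - D s"
      using no_increment(1)[of s] no_increment(2) near_1 unfolding D_def d_def by linarith
  qed
  also have "\<dots> = 2 * u - d + \<epsilon> - avg w D"
    by (simp only: avg_diff avg_const[OF w])
  also have "\<dots> \<le> 2 * (u - d) + 2 * \<epsilon>"
  proof -
    have "\<bar>d - avg w D\<bar> \<le> \<epsilon>"
      using norm_avg_smoothing_le[OF w v f(1)] f(2,3) smooth by (simp add: d_def D_def[abs_def])
    then show ?thesis by argo
  qed
  finally show ?thesis by (simp add: g_def d_def)
qed

lemma card_squared_le_sum_differences:
  assumes "weight w" "posdef (\<lambda>t. of_real (w t))"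
  shows "(real (card B))\<^sup>2 \<le> of_int N * (\<Sum>b\<in>B. \<Sum>b'\<in>B. w (b - b'))"
proof -
  have "complex_of_real ((real (card B))\<^sup>2) \<le> of_real (of_int N * (\<Sum>b\<in>B. \<Sum>b'\<in>B. w (b - b')))"
    using posdef_sum_differences_ge[OF assms(2), of B] assms(1)
    by (simp add: ft_def weight_def flip: of_real_sum)
  then show ?thesis by (simp add: less_eq_complex_def)
qed

lemma density_le_fourier_coefficient:
  fixes f :: "int \<Rightarrow> real"
  assumes w: "weight w" "posdef (\<lambda>t. of_real (w t))" and "periodic f" "0 \<le> d"
    and B: "B \<subseteq> {0..<N}" "\<beta> * of_int N \<le> real (card B)" "B \<noteq> {}"
    and off_diagonal: "\<And>b b'. b \<in> B \<Longrightarrow> b' \<in> B \<Longrightarrow> b \<noteq> b' \<Longrightarrow> f (b - b') = 0"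
    and coefficients: "\<And>r. norm (avg w (\<lambda>s. of_real (f s - d) * chr r s)) \<le> c"
  shows "d * \<beta> \<le> c + w 0 * f 0"
proof -
  define F where "F s = complex_of_real (w s * (f s - d))" for s
  let ?Q = "\<Sum>b\<in>B. \<Sum>b'\<in>B. w (b - b')"
  have "finite B" using B(1) finite_subset by blast
  then have card_pos: "real (card B) > 0" using B(3) by (simp add: card_gt_0_iff)
  have "\<beta> * of_int N * real (card B) \<le> (real (card B))\<^sup>2"
    using B(2) by (simp add: power2_eq_square mult_right_mono)
  also have "\<dots> \<le> of_int N * ?Q" by (rule card_squared_le_sum_differences[OF w])
  finally have "of_int N * (\<beta> * real (card B)) \<le> of_int N * ?Q" by (simp add: mult_ac)
  then have autocorrelation: "d * (\<beta> * real (card B)) \<le> d * ?Q"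
    using N_pos \<open>0 \<le> d\<close> by (intro mult_left_mono) auto
  have "(\<Sum>b\<in>B. \<Sum>b'\<in>B. F (b - b')) =
      of_real ((\<Sum>b\<in>B. \<Sum>b'\<in>B. w (b - b') * f (b - b')) - d * ?Q)"
    by (simp add: F_def algebra_simps sum_subtractf sum_distrib_left)
  also have "(\<Sum>b\<in>B. \<Sum>b'\<in>B. w (b - b') * f (b - b')) =
      (\<Sum>b\<in>B. \<Sum>b'\<in>B. if b' = b then w 0 * f 0 else 0)"
    by (intro sum.cong refl) (auto simp: off_diagonal)
  also have "\<dots> = real (card B) * (w 0 * f 0)" using \<open>finite B\<close> by simp
  finally have "norm (\<Sum>b\<in>B. \<Sum>b'\<in>B. F (b - b')) = \<bar>real (card B) * (w 0 * f 0) - d * ?Q\<bar>"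
    by (simp only: norm_of_real)
  moreover have "norm (\<Sum>b\<in>B. \<Sum>b'\<in>B. F (b - b')) \<le> c * real (card B)"
  proof (rule norm_sum_differences_le[OF _ B(1)])
    show "periodic F"
      using w(1) assms(3) by (simp add: F_def weight_def periodic_fun_simple_def)
    show "norm (ft F r) \<le> c" for r
      using coefficients[of r] by (simp add: avg_def ft_def F_def scaleR_conv_of_real mult.assoc)
  qed
  ultimately have "d * \<beta> * real (card B) \<le> (c + w 0 * f 0) * real (card B)"
    using autocorrelation by (simp add: algebra_simps)
  then show ?thesis using card_pos by simp
qed

subsection \<open>Bohr weights\<close>

definition bohr_dev :: "int set \<Rightarrow> int \<Rightarrow> real" where
  "bohr_dev R t = (\<Sum>r\<in>R. 1 - Re (chr r t))"

text \<open>The weight \<open>bohr M R\<close> replaces the normalised indicator function of the Bohr set with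
  frequencies \<open>R\<close> and radius \<open>1 / M\<close>, and \<open>exp (log_index M R)\<close> replaces the ratio of \<open>N\<close> to the
  size of the Bohr set.\<close>

definition log_index :: "real \<Rightarrow> int set \<Rightarrow> real" where
  "log_index M R = ln (of_int N / (\<Sum>t\<in>{0..<N}. exp (- (M\<^sup>2 * bohr_dev R t))))"

definition bohr :: "real \<Rightarrow> int set \<Rightarrow> int \<Rightarrow> real" where
  "bohr M R t = exp (log_index M R - M\<^sup>2 * bohr_dev R t) / of_int N"

lemma Re_chr_le_1: "Re (chr r t) \<le> 1"
  by (simp add: chr_def)

lemma bohr_dev_nonneg: "bohr_dev R t \<ge> 0"
  by (auto simp: bohr_dev_def Re_chr_le_1 intro!: sum_nonneg)

lemma bohr_dev_0 [simp]: "bohr_dev R 0 = 0"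
  using chr_0_left chr_commute by (simp add: bohr_dev_def)

lemma bohr_dev_minus: "bohr_dev R (- t) = bohr_dev R t"
  by (simp add: bohr_dev_def chr_minus)

lemma bohr_dev_mono: "finite S \<Longrightarrow> R \<subseteq> S \<Longrightarrow> bohr_dev R t \<le> bohr_dev S t"
  by (auto simp: bohr_dev_def Re_chr_le_1 intro!: sum_mono2)

lemma periodic_bohr_dev: "periodic (bohr_dev R)"
  using periodic_chr by (simp add: periodic_fun_simple_def bohr_dev_def)

lemma periodic_bohr: "periodic (bohr M R)"
  using periodic_bohr_dev by (simp add: periodic_fun_simple_def bohr_def)

lemma sum_exp_bohr_dev_pos: "(\<Sum>t\<in>{0..<N}. exp (- (M\<^sup>2 * bohr_dev R t))) > 0"
  using N_pos by (intro sum_pos) auto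

lemma weight_bohr: "weight (bohr M R)"
proof -
  have "bohr M R t = exp (- (M\<^sup>2 * bohr_dev R t)) / (\<Sum>s\<in>{0..<N}. exp (- (M\<^sup>2 * bohr_dev R s)))" for t
    using N_pos sum_exp_bohr_dev_pos[of M R]
    by (simp add: bohr_def log_index_def exp_diff exp_minus field_simps)
  then have "(\<Sum>t\<in>{0..<N}. bohr M R t) = 1"
    using sum_exp_bohr_dev_pos[of M R] by (simp flip: sum_divide_distrib)
  then show ?thesis
    using N_pos periodic_bohr by (simp add: weight_def bohr_def)
qed

lemma posdef_bohr:
  assumes "finite R"
  shows "posdef (\<lambda>t. of_real (bohr M R t))"
proof -
  define c where "c = exp (log_index M R - M\<^sup>2 * real (card R)) / of_int N"
  have "posdef (\<lambda>t. of_real c * exp (of_real (M\<^sup>2) * (\<Sum>r\<in>R. of_real (Re (chr r t)))))"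
    using N_pos assms
    by (intro posdef_scale posdef_exp posdef_sum posdef_Re_chr)
       (auto simp: c_def less_eq_complex_def)
  moreover have "bohr M R t = c * exp (M\<^sup>2 * (\<Sum>r\<in>R. Re (chr r t)))" for t
    by (simp add: bohr_def bohr_dev_def c_def sum_subtractf algebra_simps flip: exp_add)
  ultimately show ?thesis by (simp flip: exp_of_real)
qed

text \<open>The difference of the two sides is the relative entropy of \<open>bohr M R\<close> with respect to the
  uniform weight.\<close>

lemma avg_bohr_dev_le: "M\<^sup>2 * avg (bohr M R) (bohr_dev R) \<le> log_index M R"
proof -
  define L where "L = log_index M R"
  have "avg (bohr M R) (\<lambda>t. 1 + (M\<^sup>2 * bohr_dev R t - L)) \<le>
      avg (bohr M R) (\<lambda>t. exp (M\<^sup>2 * bohr_dev R t - L))"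
    by (intro avg_mono weight_bohr exp_ge_add_one_self)
  also have "\<dots> = 1"
    using N_pos by (simp add: avg_def bohr_def L_def flip: exp_add)
  finally show ?thesis
    by (simp add: avg_add avg_diff avg_mult_left avg_const weight_bohr L_def)
qed

lemma avg_bohr_dev_subset_le:
  assumes "finite S" "R \<subseteq> S" "0 < P" "M * P \<le> M'" "0 \<le> M" "log_index M' S \<le> H"
  shows "M\<^sup>2 * avg (bohr M' S) (bohr_dev R) \<le> H / P\<^sup>2"
proof -
  have nonneg: "0 \<le> avg (bohr M' S) (bohr_dev R)"
    by (intro avg_nonneg weight_bohr bohr_dev_nonneg)
  have "(M * P)\<^sup>2 * avg (bohr M' S) (bohr_dev R) \<le> M'\<^sup>2 * avg (bohr M' S) (bohr_dev S)"
    using assms nonneg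
    by (intro mult_mono power_mono avg_mono weight_bohr bohr_dev_mono) auto
  also have "\<dots> \<le> H" using avg_bohr_dev_le assms(6) by (rule order_trans)
  finally show ?thesis using assms(3) by (simp add: power_mult_distrib field_simps)
qed

lemma exists_many_small_bohr_dev:
  assumes "finite R" "m > 0"
  obtains T where "T \<subseteq> {0..<N}" "real_of_int N \<le> real (card T) * real m ^ card R"
    "\<And>s t. s \<in> T \<Longrightarrow> t \<in> T \<Longrightarrow> (real m)\<^sup>2 * bohr_dev R (t - s) \<le> 32 * real (card R)"
proof -
  obtain T where T: "T \<subseteq> {0..<N}" "card {0..<N} \<le> card T * m ^ card R"
    and frac: "\<And>r s t. r \<in> R \<Longrightarrow> s \<in> T \<Longrightarrow> t \<in> T \<Longrightarrow>
      \<bar>frac (of_int (r * t) / of_int N) - frac (of_int (r * s) / of_int N)\<bar> \<le> 1 / real m"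
    using pigeonhole_frac[of "{0..<N}" R m "\<lambda>r t. of_int (r * t) / of_int N"] assms by auto
  have "(real m)\<^sup>2 * bohr_dev R (t - s) \<le> 32 * real (card R)" if "s \<in> T" "t \<in> T" for s t
  proof -
    have "(real m)\<^sup>2 * (1 - Re (chr r (t - s))) \<le> 32" if "r \<in> R" for r
    proof -
      let ?a = "real_of_int (r * t) / of_int N" and ?b = "real_of_int (r * s) / of_int N"
      have "1 - Re (chr r (t - s)) = 1 - cos (2 * pi * (?a - ?b))"
        by (simp add: chr_def right_diff_distrib diff_divide_distrib)
      also have "\<dots> \<le> 32 * (frac ?a - frac ?b)\<^sup>2"
        by (rule one_minus_cos_2pi_diff_le)
      also have "\<dots> \<le> 32 * (1 / real m)\<^sup>2"
        using frac[OF \<open>r \<in> R\<close> \<open>s \<in> T\<close> \<open>t \<in> T\<close>] assms(2)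
        by (intro mult_left_mono) (auto simp flip: abs_le_square_iff)
      finally show ?thesis using assms(2) by (simp add: field_simps)
    qed
    then have "(\<Sum>r\<in>R. (real m)\<^sup>2 * (1 - Re (chr r (t - s)))) \<le> (\<Sum>r\<in>R. 32)"
      by (intro sum_mono)
    then show ?thesis by (simp add: bohr_dev_def sum_distrib_left mult.commute)
  qed
  moreover have "real_of_int N \<le> real (card T) * real m ^ card R"
    using T(2) N_pos by (simp flip: of_nat_power of_nat_mult)
  ultimately show thesis using T(1) by (intro that) auto
qed

lemma log_index_le:
  assumes "finite R" "m > 0"
  shows "log_index (real m) R \<le> real (card R) * (ln (real m) + 32)"
proof -
  obtain T where T: "T \<subseteq> {0..<N}" "real_of_int N \<le> real (card T) * real m ^ card R"
    and small: "\<And>s t. s \<in> T \<Longrightarrow> t \<in> T \<Longrightarrow> (real m)\<^sup>2 * bohr_dev R (t - s) \<le> 32 * real (card R)"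
    using exists_many_small_bohr_dev[OF assms] by blast
  define E where "E = 32 * real (card R)"
  define W where "W = (\<Sum>t\<in>{0..<N}. exp (- ((real m)\<^sup>2 * bohr_dev R t)))"
  have "W > 0" unfolding W_def by (rule sum_exp_bohr_dev_pos)
  obtain s where "s \<in> T" using T(2) N_pos by fastforce
  have "real (card T) * exp (- E) = (\<Sum>t\<in>T. exp (- E))" by simp
  also have "\<dots> \<le> (\<Sum>t\<in>T. exp (- ((real m)\<^sup>2 * bohr_dev R (t + (- s)))))"
    using small[OF \<open>s \<in> T\<close>] by (intro sum_mono) (simp add: E_def)
  also have "\<dots> \<le> (\<Sum>t\<in>{0..<N}. exp (- ((real m)\<^sup>2 * bohr_dev R (t + (- s)))))"
    using T(1) by (intro sum_mono2) auto
  also have "\<dots> = W"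
    unfolding W_def using periodic_bohr_dev
    by (intro sum_shift[where f = "\<lambda>t. exp (- ((real m)\<^sup>2 * bohr_dev R t))"])
       (simp add: periodic_fun_simple_def)
  finally have "real (card T) * real m ^ card R \<le> W * exp E * real m ^ card R"
    by (intro mult_right_mono) (auto simp: exp_minus field_simps)
  with T(2) have "of_int N / W \<le> exp E * real m ^ card R"
    using \<open>W > 0\<close> by (simp add: field_simps)
  then have "log_index (real m) R \<le> ln (exp E * real m ^ card R)"
    unfolding log_index_def W_def[symmetric] using \<open>W > 0\<close> N_pos assms(2) by simp
  also have "\<dots> = E + real (card R) * ln (real m)"
    using assms(2) by (simp add: ln_mult ln_realpow)
  finally show ?thesis by (simp add: E_def algebra_simps)
qed

lemma abs_bohr_dev_add_diff_le:
  assumes "c > 0"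
  shows "\<bar>bohr_dev R (s + t) - bohr_dev R s\<bar> \<le> c * bohr_dev R s + (1 + 1 / c) * bohr_dev R t"
proof -
  have "\<bar>Re (chr r s) - Re (chr r (s + t))\<bar>
      \<le> c * (1 - Re (chr r s)) + (1 + 1 / c) * (1 - Re (chr r t))" for r
    using abs_cos_add_diff_le[OF assms, of "2 * pi * (of_int (r * s) / of_int N)"
        "2 * pi * (of_int (r * t) / of_int N)"]
    by (simp add: chr_def distrib_left add_divide_distrib abs_minus_commute)
  then have "(\<Sum>r\<in>R. \<bar>Re (chr r s) - Re (chr r (s + t))\<bar>)
      \<le> (\<Sum>r\<in>R. c * (1 - Re (chr r s)) + (1 + 1 / c) * (1 - Re (chr r t)))"
    by (intro sum_mono)
  also have "\<dots> = c * bohr_dev R s + (1 + 1 / c) * bohr_dev R t"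
    by (simp add: bohr_dev_def sum.distrib sum_distrib_left)
  finally have "(\<Sum>r\<in>R. \<bar>Re (chr r s) - Re (chr r (s + t))\<bar>)
      \<le> c * bohr_dev R s + (1 + 1 / c) * bohr_dev R t" .
  moreover have "bohr_dev R (s + t) - bohr_dev R s = (\<Sum>r\<in>R. Re (chr r s) - Re (chr r (s + t)))"
    by (simp add: bohr_dev_def flip: sum_subtractf)
  ultimately show ?thesis
    using sum_abs[of "\<lambda>r. Re (chr r s) - Re (chr r (s + t))" R] by linarith
qed

lemma translate_dist_bohr_le:
  assumes "c > 0"
  shows "translate_dist (bohr M R) t \<le> 2 * (c * log_index M R + (1 + 1 / c) * (M\<^sup>2 * bohr_dev R t))"
proof -
  define h where "h s = M\<^sup>2 * (c * bohr_dev R s + (1 + 1 / c) * bohr_dev R t)" for s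
  let ?w = "bohr M R"
  have exponent: "\<bar>M\<^sup>2 * bohr_dev R (s + t) - M\<^sup>2 * bohr_dev R s\<bar> \<le> h s"
    "\<bar>M\<^sup>2 * bohr_dev R (s + t) - M\<^sup>2 * bohr_dev R s\<bar> \<le> h (s + t)" for s
    using abs_bohr_dev_add_diff_le[OF assms, of R s t]
      abs_bohr_dev_add_diff_le[OF assms, of R "s + t" "- t"]
    by (simp_all add: h_def abs_mult bohr_dev_minus abs_minus_commute mult_left_mono
        flip: right_diff_distrib)
  have "\<bar>?w (s + t) - ?w s\<bar> \<le> ?w (s + t) * h (s + t) + ?w s * h s" for s
  proof -
    let ?D = "\<bar>M\<^sup>2 * bohr_dev R (s + t) - M\<^sup>2 * bohr_dev R s\<bar>"
    have "\<bar>?w (s + t) - ?w s\<bar> \<le> (?w (s + t) + ?w s) * ?D"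
      using N_pos abs_exp_diff_le[of "log_index M R - M\<^sup>2 * bohr_dev R (s + t)"
          "log_index M R - M\<^sup>2 * bohr_dev R s"]
      by (simp add: bohr_def abs_minus_commute divide_right_mono
          flip: diff_divide_distrib add_divide_distrib)
    also have "\<dots> \<le> ?w (s + t) * h (s + t) + ?w s * h s"
      unfolding distrib_right
      using weight_bohr by (intro add_mono mult_left_mono exponent) (auto simp: weight_def)
    finally show ?thesis .
  qed
  then have "translate_dist ?w t \<le> (\<Sum>s\<in>{0..<N}. ?w (s + t) * h (s + t) + ?w s * h s)"
    unfolding translate_dist_def by (intro sum_mono)
  also have "\<dots> = 2 * avg ?w h"
  proof -
    have "periodic (\<lambda>s. ?w s * h s)"
      using periodic_bohr periodic_bohr_dev by (simp add: h_def periodic_fun_simple_def)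
    from sum_shift[OF this, of t] show ?thesis by (simp add: sum.distrib avg_def)
  qed
  also have "avg ?w h = c * (M\<^sup>2 * avg ?w (bohr_dev R)) + (1 + 1 / c) * (M\<^sup>2 * bohr_dev R t)"
    unfolding h_def avg_mult_left avg_add avg_const[OF weight_bohr] by (simp add: algebra_simps)
  also have "\<dots> \<le> c * log_index M R + (1 + 1 / c) * (M\<^sup>2 * bohr_dev R t)"
    using assms avg_bohr_dev_le by (intro add_right_mono mult_left_mono) auto
  finally show ?thesis by simp
qed

lemma avg_translate_dist_bohr_le:
  assumes "finite S" "R \<subseteq> S" "1 \<le> P" "M * P \<le> M'" "0 \<le> M"
    and "log_index M R \<le> H" "log_index M' S \<le> H" "0 \<le> H"
  shows "avg (bohr M' S) (translate_dist (bohr M R)) \<le> 6 * H / P"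
proof -
  let ?v = "bohr M' S"
  have "avg ?v (translate_dist (bohr M R)) \<le>
      avg ?v (\<lambda>t. 2 * (1 / P * log_index M R + (1 + P) * (M\<^sup>2 * bohr_dev R t)))"
    using translate_dist_bohr_le[of "1 / P" M R] assms(3) by (intro avg_mono weight_bohr) simp
  also have "\<dots> = 2 * (log_index M R / P + (1 + P) * (M\<^sup>2 * avg ?v (bohr_dev R)))"
    by (simp add: avg_mult_left avg_add avg_const weight_bohr)
  also have "\<dots> \<le> 2 * (H / P + (2 * P) * (H / P\<^sup>2))"
    using assms avg_bohr_dev_subset_le[of S R P M M' H]
    by (intro mult_left_mono add_mono divide_right_mono mult_mono avg_nonneg mult_nonneg_nonneg
        weight_bohr bohr_dev_nonneg) auto
  also have "\<dots> = 6 * H / P"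
    using assms(3) by (simp add: field_simps power2_eq_square)
  finally show ?thesis .
qed

lemma avg_bohr_norm_chr_diff_le:
  assumes "finite S" "r \<in> S" "0 < P" "P \<le> M" "log_index M S \<le> H" "1 \<le> H"
  shows "avg (bohr M S) (\<lambda>t. norm (chr r t - 1)) \<le> 2 * H / P"
proof -
  have "norm (chr r t - 1) \<le> 1 / (2 * P) + P * bohr_dev {r} t" for t
  proof -
    have "(norm (chr r t - 1))\<^sup>2 = 2 * bohr_dev {r} t"
    proof -
      have "(Re (chr r t))\<^sup>2 + (Im (chr r t))\<^sup>2 = 1"
        using norm_chr[of r t] by (metis cmod_power2 power_one)
      then show ?thesis
        unfolding cmod_power2 by (simp add: bohr_dev_def power2_eq_square algebra_simps)
    qed
    then show ?thesis
      using abs_mult_le_weighted_squares[of "1 / P" 1 "norm (chr r t - 1)"] assms(3)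
      by (simp add: field_simps)
  qed
  then have "avg (bohr M S) (\<lambda>t. norm (chr r t - 1)) \<le>
      avg (bohr M S) (\<lambda>t. 1 / (2 * P) + P * bohr_dev {r} t)"
    by (intro avg_mono weight_bohr)
  also have "\<dots> = 1 / (2 * P) + P * avg (bohr M S) (bohr_dev {r})"
    by (simp add: avg_add avg_mult_left avg_const weight_bohr)
  also have "\<dots> \<le> H / P + P * (H / P\<^sup>2)"
    using assms avg_bohr_dev_subset_le[of S "{r}" P 1 M H]
    by (intro add_mono mult_left_mono) (auto simp: field_simps)
  also have "\<dots> = 2 * H / P"
    using assms(3) by (simp add: power2_eq_square)
  finally show ?thesis .
qed

end

definition index_bound :: "nat \<Rightarrow> nat \<Rightarrow> real" where
  "index_bound P J = real J * (2 * real J * ln (real P) + 32)"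

lemma index_bound_le:
  assumes "1 \<le> m"
  shows "index_bound ((2 ^ 24 * m ^ 9)\<^sup>2) (32 * m ^ 3) \<le> 2 ^ 40 * real m ^ 15"
proof -
  define J where "J = real (32 * m ^ 3)"
  define Q where "Q = real (2 ^ 24 * m ^ 9)"
  have "1 \<le> real m ^ k" for k using assms by simp
  from this[of 3] this[of 9] have "1 \<le> J" "1 \<le> Q" by (simp_all add: J_def Q_def)
  have "index_bound ((2 ^ 24 * m ^ 9)\<^sup>2) (32 * m ^ 3) = J * (2 * J * ln (Q\<^sup>2) + 32)"
    by (simp add: index_bound_def J_def Q_def)
  also have "\<dots> \<le> J * (2 * J * (2 * Q) + 32 * (J * Q))"
    using \<open>1 \<le> J\<close> \<open>1 \<le> Q\<close> ln_bound[of Q] mult_mono[of 1 J 1 Q]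
    by (intro mult_left_mono add_mono) (auto simp: ln_realpow)
  also have "\<dots> = 36 * 2 ^ 34 * real m ^ 15"
    by (simp add: J_def Q_def flip: power_add)
  also have "\<dots> \<le> 2 ^ 40 * real m ^ 15" by simp
  finally show ?thesis .
qed

context cyclic_sums
begin

lemma log_index_power_le:
  assumes "finite S" "1 \<le> P" "card S \<le> J" "i \<le> 2 * J"
  shows "log_index (real P ^ i) S \<le> index_bound P J"
proof -
  have "log_index (real P ^ i) S \<le> real (card S) * (real i * ln (real P) + 32)"
    using log_index_le[of S "P ^ i"] assms by (simp add: ln_realpow)
  also have "\<dots> \<le> real J * (real (2 * J) * ln (real P) + 32)"
    using assms by (intro mult_mono add_right_mono of_nat_mono) auto
  finally show ?thesis by (simp add: index_bound_def)
qed

subsection \<open>The density increment\<close>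

definition dens :: "int set \<Rightarrow> (int \<Rightarrow> real) \<Rightarrow> int \<Rightarrow> real" where
  "dens X w a = avg w (\<lambda>t. of_bool (a + t \<in> X))"

lemma dens_le_1: "weight w \<Longrightarrow> dens X w a \<le> 1"
  by (simp add: dens_def avg_le_1)

lemma dens_bohr_empty:
  "dens X (bohr M {}) 0 = real (card (X \<inter> {0..<N})) / of_int N"
  using N_pos by (simp add: dens_def avg_def bohr_def log_index_def bohr_dev_def Int_commute
      flip: sum_divide_distrib)

lemma periodic_translate_mem:
  assumes "periodic (\<lambda>t. t \<in> X)"
  shows "periodic (\<lambda>s. f (a + s \<in> X))"
  using assms by (simp add: periodic_fun_simple_def flip: add.assoc)

lemma exists_mem_dens_ge:
  assumes w: "weight w" and v: "weight v" and X: "periodic (\<lambda>t. t \<in> X)"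
    and smooth: "avg v (translate_dist w) \<le> \<epsilon>"
    and no_increment: "\<And>s. dens X v s \<le> u" "dens X w a \<le> u"
    and gap: "u - dens X w a + \<epsilon> < \<tau> * dens X w a"
  shows "\<exists>x\<in>X. dens X w a - \<tau> \<le> dens X v x"
proof (rule ccontr)
  define d where "d = dens X w a"
  assume "\<not> ?thesis"
  then have "dens X v (a + s) \<le> u - \<tau> * of_bool (a + s \<in> X)" for s
    using no_increment(1)[of "a + s"] no_increment(2) by (cases "a + s \<in> X") (force simp: not_le)+
  then have "avg w (\<lambda>s. dens X v (a + s)) \<le> avg w (\<lambda>s. u - \<tau> * of_bool (a + s \<in> X))"
    by (intro avg_mono w)
  also have "\<dots> = u - \<tau> * d"
    by (simp only: avg_diff avg_mult_left avg_const[OF w] d_def dens_def)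
  finally have "avg w (\<lambda>s. dens X v (a + s)) \<le> u - \<tau> * d" .
  moreover have "\<bar>d - avg w (\<lambda>s. dens X v (a + s))\<bar> \<le> \<epsilon>"
  proof -
    have "periodic (\<lambda>s. of_bool (a + s \<in> X) :: real)" by (rule periodic_translate_mem[OF X])
    from norm_avg_smoothing_le[OF w v this] smooth show ?thesis
      by (simp add: d_def dens_def add.assoc)
  qed
  ultimately show False using gap by (simp add: d_def)
qed

end

text \<open>\<open>X\<close> and the \<open>B x\<close> represent subsets of the cyclic group of order \<open>N\<close>, as an \<open>N\<close>-periodic set
  and as sets of residues respectively.\<close>

locale sparse_columns = cyclic_sums +
  fixes X :: "int set" and B :: "int \<Rightarrow> int set" and \<beta> :: real
  assumes X_periodic: "periodic (\<lambda>t. t \<in> X)"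
    and \<beta>_pos: "\<beta> > 0"
    and X_dense: "\<beta> * of_int N \<le> real (card (X \<inter> {0..<N}))"
    and B_subset: "x \<in> X \<Longrightarrow> B x \<subseteq> {0..<N}"
    and B_dense: "x \<in> X \<Longrightarrow> \<beta> * of_int N \<le> real (card (B x))"
    and B_differences: "x \<in> X \<Longrightarrow> b \<in> B x \<Longrightarrow> b' \<in> B x \<Longrightarrow> x + (b - b') \<in> X \<Longrightarrow> b = b'"
begin

lemma dens_empty_ge: "\<beta> \<le> dens X (bohr M {}) 0"
  using X_dense N_pos by (simp add: dens_bohr_empty pos_le_divide_eq)

lemma \<beta>_le_1: "\<beta> \<le> 1"
  using dens_empty_ge[of 1] dens_le_1[OF weight_bohr[of 1 "{}"], of X 0] by linarith

lemma B_nonempty: "x \<in> X \<Longrightarrow> B x \<noteq> {}"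
  using B_dense[of x] mult_pos_pos[OF \<beta>_pos, of "of_int N"] N_pos by auto

lemma dens_mem_le:
  assumes x: "x \<in> X" and w: "weight w" "posdef (\<lambda>t. of_real (w t))" and v: "\<And>r. weight (v r)"
    and smooth: "\<And>r. avg (v r) (translate_dist w) \<le> \<epsilon>"
    and near_1: "\<And>r. avg (v r) (\<lambda>t. norm (chr r t - 1)) \<le> \<epsilon>"
    and no_increment: "\<And>r s. dens X (v r) s \<le> u" "dens X w x \<le> u"
  shows "dens X w x * \<beta> \<le> 2 * (u - dens X w x) + 3 * \<epsilon> + w 0"
proof -
  define f where "f s = (of_bool (x + s \<in> X) :: real)" for s
  have "periodic f" unfolding f_def by (rule periodic_translate_mem[OF X_periodic])
  have dens: "dens X w x = avg w f" by (simp add: dens_def f_def[abs_def])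
  have no_increment_f: "avg (v r) (\<lambda>t. f (s + t)) \<le> u" for r s
    using no_increment(1)[of r "x + s"] by (simp add: dens_def f_def add.assoc)
  have "avg w f * \<beta> \<le> 2 * (u - avg w f) + 3 * \<epsilon> + w 0 * f 0"
  proof (rule density_le_fourier_coefficient[OF w \<open>periodic f\<close>])
    show "norm (avg w (\<lambda>s. of_real (f s - avg w f) * chr r s)) \<le> 2 * (u - avg w f) + 3 * \<epsilon>" for r
      using no_increment_f no_increment(2)
      by (intro norm_fourier_coefficient_le[OF w(1) v \<open>periodic f\<close> _ _ smooth near_1])
         (simp_all add: dens f_def)
    show "f (b - b') = 0" if "b \<in> B x" "b' \<in> B x" "b \<noteq> b'" for b b'
      using B_differences[OF x that(1,2)] that(3) by (auto simp: f_def)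
  qed (use x w B_subset B_dense B_nonempty in \<open>auto simp: f_def avg_nonneg\<close>)
  then show ?thesis using x by (simp add: dens f_def)
qed

definition gain :: real where
  "gain = \<beta> ^ 3 / 32"

lemma gain_pos: "0 < gain"
  using \<beta>_pos by (simp add: gain_def)

text \<open>An increment on \<open>w'\<close> is sought first, since its absence provides a translate of \<open>w'\<close> centred
  at a point of \<open>X\<close> on which the density has hardly dropped.\<close>

lemma weight_density_increment:
  assumes w: "weight w" "weight w'" "posdef (\<lambda>t. of_real (w' t))" and v: "\<And>r. weight (v r)"
    and smooth: "avg w' (translate_dist w) \<le> gain"
      "\<And>r. avg (v r) (translate_dist w') \<le> gain"
    and near_1: "\<And>r. avg (v r) (\<lambda>t. norm (chr r t - 1)) \<le> gain"
    and spread: "w' 0 \<le> \<beta>\<^sup>2 / 4"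
    and dense: "\<beta> \<le> dens X w a"
  shows "\<exists>s. dens X w a + gain \<le> dens X w' s \<or> (\<exists>r. dens X w a + gain \<le> dens X (v r) s)"
proof (rule ccontr)
  define d where "d = dens X w a"
  assume "\<not> ?thesis"
  then have no_increment: "dens X w' s \<le> d + gain" "dens X (v r) s \<le> d + gain" for r s
    unfolding d_def by (meson linear)+
  have square: "0 < \<beta>\<^sup>2" "\<beta>\<^sup>2 \<le> \<beta>"
    using \<beta>_pos \<beta>_le_1 by (simp_all add: power2_eq_square mult_left_le)
  have gain: "\<beta>\<^sup>2 / 8 * \<beta> = 4 * gain" "gain \<le> \<beta>\<^sup>2 / 32"
    using \<beta>_pos \<beta>_le_1 by (auto simp: gain_def power3_eq_cube power2_eq_square mult_left_le)
  have "\<exists>x\<in>X. dens X w a - \<beta>\<^sup>2 / 8 \<le> dens X w' x"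
  proof (rule exists_mem_dens_ge[OF w(1,2) X_periodic smooth(1)])
    have "\<beta>\<^sup>2 / 8 * \<beta> \<le> \<beta>\<^sup>2 / 8 * d" using dense by (intro mult_left_mono) (auto simp: d_def)
    then show "d + gain - dens X w a + gain < \<beta>\<^sup>2 / 8 * dens X w a"
      using gain gain_pos by (simp add: d_def)
  qed (use gain_pos no_increment in \<open>simp_all add: d_def\<close>)
  then obtain x where x: "x \<in> X" "d - \<beta>\<^sup>2 / 8 \<le> dens X w' x" unfolding d_def by blast
  have "dens X w' x * \<beta> \<le> 2 * (d + gain - dens X w' x) + 3 * gain + w' 0"
    using no_increment by (intro dens_mem_le[OF x(1) w(2,3) v smooth(2) near_1])
  moreover have "7 / 8 * \<beta>\<^sup>2 \<le> dens X w' x * \<beta>"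
  proof -
    have "7 / 8 * \<beta> \<le> dens X w' x" using square x(2) dense by (simp add: d_def)
    then have "7 / 8 * \<beta> * \<beta> \<le> dens X w' x * \<beta>" using \<beta>_pos by (intro mult_right_mono) auto
    then show ?thesis by (simp add: power2_eq_square)
  qed
  ultimately have "7 / 8 * \<beta>\<^sup>2 \<le> 2 * (d + gain - dens X w' x) + 3 * gain + w' 0" by simp
  then show False using x(2) gain square spread by argo
qed

lemma bohr_density_increment:
  assumes R: "finite R" and "1 \<le> M" "1 \<le> P" "1 \<le> H"
    and index: "\<And>S i. finite S \<Longrightarrow> card S \<le> Suc (card R) \<Longrightarrow> i \<le> 2 \<Longrightarrow> log_index (M * P ^ i) S \<le> H"
    and step: "6 * H / P \<le> gain"
    and order: "exp H / of_int N \<le> \<beta>\<^sup>2 / 4"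
    and dense: "\<beta> \<le> dens X (bohr M R) a"
  shows "\<exists>S i s. finite S \<and> card S \<le> Suc (card R) \<and> i \<le> 2 \<and>
    dens X (bohr M R) a + gain \<le> dens X (bohr (M * P ^ i) S) s"
proof -
  have index_R: "log_index M R \<le> H" "log_index (M * P) R \<le> H"
    and index_insert: "log_index (M * P\<^sup>2) (insert r R) \<le> H" for r
    using index[of R 0] index[of R 1] index[of "insert r R" 2] R by (simp_all add: card_insert_if)
  have "\<exists>s. dens X (bohr M R) a + gain \<le> dens X (bohr (M * P ^ 1) R) s \<or>
    (\<exists>r. dens X (bohr M R) a + gain \<le> dens X (bohr (M * P ^ 2) (insert r R)) s)"
  proof (rule weight_density_increment)
    show "avg (bohr (M * P ^ 1) R) (translate_dist (bohr M R)) \<le> gain"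
      using assms index_R by (intro order_trans[OF avg_translate_dist_bohr_le step]) auto
    show "avg (bohr (M * P ^ 2) (insert r R)) (translate_dist (bohr (M * P ^ 1) R)) \<le> gain" for r
      using assms index_R index_insert
      by (intro order_trans[OF avg_translate_dist_bohr_le step]) (auto simp: power2_eq_square)
    have "2 * H / P \<le> 6 * H / P" using assms(3,4) by (intro divide_right_mono) auto
    moreover have "1 * P \<le> M * P\<^sup>2" using assms(2,3) self_le_power[of P 2] by (intro mult_mono) auto
    ultimately show "avg (bohr (M * P ^ 2) (insert r R)) (\<lambda>t. norm (chr r t - 1)) \<le> gain" for r
      using avg_bohr_norm_chr_diff_le[of "insert r R" r P "M * P\<^sup>2" H] assms index_insert
      by fastforce
    have "bohr (M * P ^ 1) R 0 \<le> exp H / of_int N"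
      using index_R N_pos by (simp add: bohr_def divide_right_mono)
    then show "bohr (M * P ^ 1) R 0 \<le> \<beta>\<^sup>2 / 4" using order by (rule order_trans)
  qed (intro weight_bohr posdef_bohr R dense)+
  then obtain s S i where "S = R \<and> i = 1 \<or> (\<exists>r. S = insert r R \<and> i = (2 :: nat))"
    "dens X (bohr M R) a + gain \<le> dens X (bohr (M * P ^ i) S) s"
    by metis
  then show ?thesis
    using R by (intro exI[of _ S] exI[of _ i] exI[of _ s]) (auto simp: card_insert_if)
qed

lemma iterated_density_increment:
  assumes "1 \<le> P" "1 \<le> J"
    and step: "6 * index_bound P J / real P \<le> gain"
    and order: "exp (index_bound P J) / of_int N \<le> \<beta>\<^sup>2 / 4"
  shows "j \<le> J \<Longrightarrow> \<exists>R i a. finite R \<and> card R \<le> j \<and> i \<le> 2 * j \<and>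
    \<beta> + real j * gain \<le> dens X (bohr (real P ^ i) R) a"
proof (induction j)
  case 0
  show ?case using dens_empty_ge by (intro exI[of _ "{}"] exI[of _ 0]) auto
next
  case (Suc j)
  then obtain R i a where R: "finite R" "card R \<le> j" "i \<le> 2 * j"
    and dens_R: "\<beta> + real j * gain \<le> dens X (bohr (real P ^ i) R) a"
    by auto
  have "\<exists>S k a'. finite S \<and> card S \<le> Suc (card R) \<and> k \<le> 2 \<and>
    dens X (bohr (real P ^ i) R) a + gain \<le> dens X (bohr (real P ^ i * real P ^ k) S) a'"
  proof (rule bohr_density_increment[OF R(1) _ _ _ _ step order])
    have "1 * 32 \<le> index_bound P J"
      unfolding index_bound_def using assms(1,2) by (intro mult_mono) auto
    then show "1 \<le> index_bound P J" by simp
    show "log_index (real P ^ i * real P ^ k) S \<le> index_bound P J"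
      if "finite S" "card S \<le> Suc (card R)" "k \<le> 2" for S k
      using log_index_power_le[of S P J "i + k"] that R Suc.prems assms(1) by (simp add: power_add)
    have "0 \<le> real j * gain" using gain_pos by simp
    then show "\<beta> \<le> dens X (bohr (real P ^ i) R) a" using dens_R by linarith
  qed (use assms(1) in auto)
  then obtain S k a' where S: "finite S" "card S \<le> Suc (card R)" "k \<le> 2"
    and dens_S: "dens X (bohr (real P ^ i) R) a + gain \<le> dens X (bohr (real P ^ (i + k)) S) a'"
    by (auto simp: power_add)
  have "\<beta> + real (Suc j) * gain \<le> dens X (bohr (real P ^ (i + k)) S) a'"
    using dens_R dens_S unfolding of_nat_Suc distrib_right by linarith
  then show ?case using R S by (intro exI[of _ S] exI[of _ "i + k"] exI[of _ a']) auto
qed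

lemma group_order_less:
  assumes "1 \<le> P" "1 \<le> J" "1 \<le> real J * gain"
    and "6 * index_bound P J / real P \<le> gain"
  shows "of_int N < 4 / \<beta>\<^sup>2 * exp (index_bound P J)"
proof (rule ccontr)
  assume "\<not> ?thesis"
  then have "exp (index_bound P J) / of_int N \<le> \<beta>\<^sup>2 / 4"
    using N_pos \<beta>_pos by (simp add: field_simps)
  then obtain R i a where "\<beta> + real J * gain \<le> dens X (bohr (real P ^ i) R) a"
    using iterated_density_increment[OF assms(1,2,4), of J] by blast
  then show False
    using assms(3) \<beta>_pos dens_le_1[OF weight_bohr, of X "real P ^ i" R a] by linarith
qed

lemma ln_group_order_le: "\<beta> ^ 15 * ln (of_int N) \<le> 2 ^ 56"
proof -
  define m where "m = nat \<lceil>1 / \<beta>\<rceil>"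
  \<comment> \<open>\<open>P\<close> is a square so that \<open>ln P \<le> 2 * sqrt P\<close> keeps the index bound of order \<open>J\<^sup>2 * sqrt P\<close>.\<close>
  define J P where "J = 32 * m ^ 3" and "P = (2 ^ 24 * m ^ 9)\<^sup>2"
  define H where "H = index_bound P J"
  have "1 / \<beta> \<le> real m" "real m \<le> 1 / \<beta> + 1"
    using \<beta>_pos real_nat_ceiling_ge[of "1 / \<beta>"] of_int_ceiling_le_add_one[of "1 / \<beta>"]
    by (simp_all add: m_def)
  then have m: "1 \<le> \<beta> * real m" "\<beta> * real m \<le> 2"
    using \<beta>_pos \<beta>_le_1 by (simp_all add: field_simps)
  then have "m \<noteq> 0" by (intro notI) simp
  have "1 \<le> J" "1 \<le> P" using \<open>m \<noteq> 0\<close> by (simp_all add: J_def P_def)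
  have cube: "1 \<le> \<beta> ^ 3 * real m ^ 3"
    using one_le_power[OF m(1), of 3] by (simp add: power_mult_distrib)
  have H_le: "H \<le> 2 ^ 40 * real m ^ 15"
    unfolding H_def J_def P_def using \<open>m \<noteq> 0\<close> by (intro index_bound_le) simp
  have "192 * H \<le> 192 * (2 ^ 40 * real m ^ 15)" using H_le by simp
  also have "\<dots> \<le> 2 ^ 48 * real m ^ 15" by simp
  also have "\<dots> \<le> 2 ^ 48 * real m ^ 15 * (\<beta> ^ 3 * real m ^ 3)"
    using mult_left_mono[OF cube, of "2 ^ 48 * real m ^ 15"] by simp
  also have "\<dots> = \<beta> ^ 3 * real P"
    by (simp add: P_def power_mult_distrib flip: power_mult power_add)
  finally have "6 * H / real P \<le> gain" using \<open>1 \<le> P\<close> by (simp add: gain_def field_simps)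
  then have "of_int N < 4 / \<beta>\<^sup>2 * exp H"
    using group_order_less[of P J] cube \<open>1 \<le> J\<close> \<open>1 \<le> P\<close>
    by (simp add: gain_def H_def J_def mult.commute)
  then have "ln (of_int N) \<le> ln (4 / \<beta>\<^sup>2 * exp H)"
    using N_pos by (subst ln_le_cancel_iff) (auto intro: less_trans)
  also have "\<dots> = ln (4 / \<beta>\<^sup>2) + H" using \<beta>_pos by (subst ln_mult) auto
  also have "\<dots> \<le> 4 / \<beta>\<^sup>2 + H" using \<beta>_pos ln_bound[of "4 / \<beta>\<^sup>2"] by simp
  finally have "\<beta> ^ 15 * ln (of_int N) \<le> \<beta> ^ 15 * (4 / \<beta>\<^sup>2 + 2 ^ 40 * real m ^ 15)"
    using \<beta>_pos H_le by (intro mult_left_mono) auto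
  also have "\<dots> = 4 * \<beta> ^ 13 + 2 ^ 40 * (\<beta> * real m) ^ 15"
    using \<beta>_pos by (simp add: field_simps flip: power_add)
  also have "\<dots> \<le> 4 * 1 + 2 ^ 40 * 2 ^ 15"
    using m \<beta>_pos \<beta>_le_1 by (intro add_mono mult_left_mono power_mono power_le_one) auto
  finally show ?thesis by simp
qed

end

subsection \<open>Skew corners\<close>

definition popular_columns :: "real \<Rightarrow> ('a \<times> 'b) set \<Rightarrow> 'a set" where
  "popular_columns \<tau> A = {x \<in> Domain A. \<tau> \<le> real (card (A `` {x}))}"

lemma card_le_popular_columns:
  assumes "finite I" "finite J" "A \<subseteq> I \<times> J" "0 \<le> \<tau>"
  shows "real (card A) \<le> real (card (popular_columns \<tau> A)) * real (card J) + real (card I) * \<tau>"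
proof -
  let ?P = "popular_columns \<tau> A"
  have columns: "A `` {x} \<subseteq> J" for x using assms(3) by auto
  have "A = (SIGMA x:I. A `` {x})" using assms(3) by auto
  moreover have "finite (A `` {x})" for x using columns assms(2) finite_subset by blast
  ultimately have "card A = (\<Sum>x\<in>I. card (A `` {x}))"
    using card_SigmaI[of I "\<lambda>x. A `` {x}"] assms(1) by simp
  then have "real (card A) = (\<Sum>x\<in>I. real (card (A `` {x})))" by simp
  also have "\<dots> \<le> (\<Sum>x\<in>I. of_bool (x \<in> ?P) * real (card J) + \<tau>)"
  proof (intro sum_mono)
    fix x
    have "A `` {x} = {}" if "x \<notin> Domain A" using that by blast
    then show "real (card (A `` {x})) \<le> of_bool (x \<in> ?P) * real (card J) + \<tau>"
      using card_mono[OF assms(2) columns[of x]] assms(4)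
      by (cases "x \<in> ?P"; cases "x \<in> Domain A") (simp_all add: popular_columns_def)
  qed
  also have "\<dots> = real (card (I \<inter> ?P)) * real (card J) + real (card I) * \<tau>"
    using assms(1) by (simp add: sum.distrib flip: sum_distrib_right)
  also have "I \<inter> ?P = ?P" using assms(3) by (auto simp: popular_columns_def)
  finally show ?thesis .
qed

lemma skew_corner_freeD:
  assumes "skew_corner_free A" "(x, b) \<in> A" "(x, b') \<in> A" "(x + (b - b'), y) \<in> A"
  shows "b = b'"
proof (rule ccontr)
  assume "b \<noteq> b'"
  moreover have "skew_corner x b' y (b - b') \<subseteq> A"
    using assms by (simp add: skew_corner_def)
  ultimately show False
    using assms(1) unfolding skew_corner_free_def by (metis right_minus_eq)
qed

text \<open>The modulus \<open>4 * n\<close> is large enough that no relation between two columns and a difference of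
  ordinates wraps around.\<close>

lemma eq_if_mod_eq_add_diff:
  assumes "{y, z, b, b'} \<subseteq> {1..int n}" "z mod (4 * int n) = (y + (b - b')) mod (4 * int n)"
  shows "z = y + (b - b')"
proof -
  have "4 * int n dvd (y + (b - b')) - z" using assms(2) by (metis mod_eq_dvd_iff)
  moreover have "\<bar>(y + (b - b')) - z\<bar> < 4 * int n" using assms(1) by auto
  ultimately show ?thesis
    using zdvd_not_zless[of "\<bar>(y + (b - b')) - z\<bar>" "4 * int n"] by auto
qed

lemma sparse_columns_skew_corner_free:
  fixes n :: nat
  assumes n: "1 \<le> n" and A: "A \<subseteq> {1..int n} \<times> {1..int n}" "skew_corner_free A" "A \<noteq> {}"
  defines "X \<equiv> popular_columns (real (card A) / (2 * real n)) A"
  shows "sparse_columns (4 * int n) {t. t mod (4 * int n) \<in> X} (\<lambda>x. A `` {x mod (4 * int n)})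
    (real (card A) / (8 * (real n)\<^sup>2))"
proof
  let ?N = "4 * int n" and ?\<beta> = "real (card A) / (8 * (real n)\<^sup>2)"
  have "finite A" using A(1) finite_subset by blast
  have X: "X \<subseteq> {1..int n}" using A(1) by (auto simp: X_def popular_columns_def)
  have threshold: "?\<beta> * of_int ?N = real (card A) / (2 * real n)"
    using n by (simp add: power2_eq_square)
  show "?N > 0" using n by simp
  show "?\<beta> > 0" using n A(3) \<open>finite A\<close> by (simp add: card_gt_0_iff)
  show "t + ?N \<in> {t. t mod ?N \<in> X} \<longleftrightarrow> t \<in> {t. t mod ?N \<in> X}" for t by simp
  have "real (card A) \<le> real (card X) * real n + real n * (real (card A) / (2 * real n))"
    using A(1) card_le_popular_columns[of "{1..int n}" "{1..int n}" A "real (card A) / (2 * real n)"]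
    by (simp add: X_def)
  then have "real (card A) / (2 * real n) \<le> real (card X)" using n by (simp add: field_simps)
  moreover have "{t. t mod ?N \<in> X} \<inter> {0..<?N} = X" using X n by force
  ultimately show "?\<beta> * of_int ?N \<le> real (card ({t. t mod ?N \<in> X} \<inter> {0..<?N}))"
    by (simp only: threshold)
  show "A `` {x mod ?N} \<subseteq> {0..<?N}" for x
    using A(1) n by force
  show "?\<beta> * of_int ?N \<le> real (card (A `` {x mod ?N}))" if "x \<in> {t. t mod ?N \<in> X}" for x
    using that unfolding threshold by (simp add: X_def popular_columns_def)
  show "b = b'" if x: "x \<in> {t. t mod ?N \<in> X}" and b: "b \<in> A `` {x mod ?N}" "b' \<in> A `` {x mod ?N}"
    and x': "x + (b - b') \<in> {t. t mod ?N \<in> X}" for x b b'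
  proof -
    define y z where "y = x mod ?N" and "z = (x + (b - b')) mod ?N"
    have "{y, z, b, b'} \<subseteq> {1..int n}"
      using x x' X b A(1) by (auto simp: y_def z_def)
    moreover have "z mod ?N = (y + (b - b')) mod ?N" by (simp add: y_def z_def mod_simps)
    ultimately have "z = y + (b - b')" by (rule eq_if_mod_eq_add_diff)
    moreover obtain y' where "(z, y') \<in> A"
      using x' by (auto simp: X_def popular_columns_def z_def)
    ultimately show "b = b'"
      using skew_corner_freeD[OF A(2)] b unfolding y_def by blast
  qed
qed

lemma card_skew_corner_free_le:
  assumes "2 \<le> n" "A \<subseteq> {1..int n} \<times> {1..int n}" "skew_corner_free A"
  shows "real (card A) \<le> 8 * (2 ^ 56) powr (1 / 15) * ((real n)\<^sup>2 / ln (real n) powr (1 / 15))"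
proof (cases "A = {}")
  case False
  define \<beta> where "\<beta> = real (card A) / (8 * (real n)\<^sup>2)"
  interpret sparse_columns "4 * int n"
    "{t. t mod (4 * int n) \<in> popular_columns (real (card A) / (2 * real n)) A}"
    "\<lambda>x. A `` {x mod (4 * int n)}" \<beta>
    unfolding \<beta>_def using assms False by (intro sparse_columns_skew_corner_free) auto
  have ln: "0 < ln (real n)" "ln (real n) \<le> ln (of_int (4 * int n))" using assms(1) by simp_all
  have "\<beta> ^ 15 * ln (real n) \<le> \<beta> ^ 15 * ln (of_int (4 * int n))"
    using ln(2) \<beta>_pos by (intro mult_left_mono) auto
  also have "\<dots> \<le> 2 ^ 56" by (rule ln_group_order_le)
  finally have "\<beta> ^ 15 * ln (real n) \<le> 2 ^ 56" .
  then have "root 15 (\<beta> ^ 15) \<le> root 15 (2 ^ 56 / ln (real n))"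
    using ln(1) by (simp add: field_simps)
  then have "\<beta> \<le> (2 ^ 56 / ln (real n)) powr (1 / 15)"
    using \<beta>_pos ln(1) by (simp add: real_root_power_cancel root_powr_inverse[of 15 "_ / _"])
  also have "\<dots> = (2 ^ 56) powr (1 / 15) / ln (real n) powr (1 / 15)"
    using ln(1) by (simp add: powr_divide)
  finally show ?thesis
    using assms(1) by (simp add: \<beta>_def divide_le_eq mult_ac)
qed simp

theorem theorem2:
  shows "\<exists>c\<^sub>2 :: real. c\<^sub>2 > 0 \<and>
    (\<lambda>n. real (max_skew_corner_free n)) \<in> O(\<lambda>n. (real n)\<^sup>2 / ln (real n) powr c\<^sub>2)"
proof (intro exI conjI)
  have "real (max_skew_corner_free n) \<le>
      8 * (2 ^ 56) powr (1 / 15) * ((real n)\<^sup>2 / ln (real n) powr (1 / 15))"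
    if "2 \<le> n" for n
  proof -
    have "max_skew_corner_free n \<in> card ` {A. A \<subseteq> {1..int n} \<times> {1..int n} \<and> skew_corner_free A}"
      unfolding max_skew_corner_free_def
      using finite_skew_corner_free_subsets skew_corner_free_empty
      by (intro Max_in) auto
    then show ?thesis using card_skew_corner_free_le[OF that] by auto
  qed
  then show "(\<lambda>n. real (max_skew_corner_free n)) \<in> O(\<lambda>n. (real n)\<^sup>2 / ln (real n) powr (1 / 15))"
    by (intro bigoI eventually_mono[OF eventually_ge_at_top[of 2]]) auto
qed simp

end
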